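(* Assume that $$L_f:=\sup_{y\in Y}\|A^*x(y)+\psi'(y)\|_*<\infty,\qquad x(y)=x_X(Ay+a).$$ Then for every $t=1,2,\dots$, the $t$-step Mirror Descent algorithm applied to the vector field $g=f'$ with the stepsizes $$\gamma_\tau=\frac{\Omega}{\sqrt{t}\,\|f'(y_\tau)\|_*},\quad 1\le\tau\le t$$ (it being assumed that $f'(y_\tau)\ne0$ for $\tau\le t$) yields feasible approximate solutions $$\widehat{x}^t=\sum_{\tau=1}^t\lambda^t_\tau\, x(y_\tau)\in X,\qquad \widehat{y}^t=\sum_{\tau=1}^t\lambda^t_\tau\, y_\tau\in Y,\qquad \lambda^t_\tau=\frac{\gamma_\tau}{\sum_{s=1}^t\gamma_s},$$ to $(P)$ and $(D)$ such that $$[f(\widehat{y}^t)-\mathrm{Opt}(P)]+[\mathrm{Opt}(D)-f_*(\widehat{x}^t)]\le\frac{\Omega L_f}{\sqrt{t}} .$$ In particular, given $\epsilon>0$, it takes at most $$t(\epsilon)=\left\lceil \frac{\Omega^2L_f^2}{\epsilon^2}\right\rceil$$ steps of the algorithm to ensure that $$[f(\widehat{y}^t)-\mathrm{Opt}(P)]+[\mathrm{Opt}(D)-f_*(\widehat{x}^t)]\le\epsilon .$$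
   Context: Problem data. $E_x,E_y$ are Euclidean spaces with inner products $\langle\cdot,\cdot\rangle$. $X\subset E_x$ is a nonempty closed and bounded convex set, and for every $\xi\in E_x$, $x_X(\xi)$ is a fixed (oracle-supplied) maximizer of $\langle\xi,x\rangle$ over $x\in X$. $Y\subset E_y$ is a nonempty convex compact set, $A:E_y\to E_x$ is linear with adjoint $A^*$, $a\in E_x$, $\psi:Y\to\mathbf{R}$ is convex and Lipschitz continuous, and $\psi'(y)\in\partial\psi(y)$ is a fixed selection of subgradients on $Y$. Set $$f_*(x)=\min_{y\in Y}[\langle x,Ay+a\rangle+\psi(y)],\qquad f(y)=\max_{x\in X}[\langle x,Ay+a\rangle+\psi(y)],$$ $$(P):\ \mathrm{Opt}(P)=\max_{x\in X}f_*(x),\qquad (D):\ \mathrm{Opt}(D)=\min_{y\in Y}f(y),$$ and $f'(y)=A^*x_X(Ay+a)+\psi'(y)$, $y\in Y$. Proximal setup. $\|\cdot\|$ is a norm on $E_y$ and $\|\cdot\|_*$ is its conjugate (dual) norm. $\omega:Y\to\mathbf{R}$ is a distance-generating function: it is continuous and convex on $Y$, admits a selection $\omega'(y)\in\partial\omega(y)$ of subgradients that is continuous in $y\in Y^o:=\{y\in Y:\partial\omega(y)\neq\emptyset\}$, and is strongly convex with modulus 1 w.r.t. $\|\cdot\|$: $\langle\omega'(y)-\omega'(y'),y-y'\rangle\ge\|y-y'\|^2$ for all $y,y'\in Y^o$. Put $$\Omega=\Omega[Y,\omega(\cdot)]:=\sqrt{2\left[\max_{y\in Y}\omega(y)-\min_{y\in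 Y}\omega(y)\right]},\qquad y_\omega=\mathrm{argmin}_{y\in Y}\,\omega(y),$$ $$V_y(z)=\omega(z)-\omega(y)-\langle\omega'(y),z-y\rangle\ (y\in Y^o,z\in Y),\qquad \mathrm{Prox}_y(\xi)=\mathrm{argmin}_{z\in Y}\left[\langle\xi,z\rangle+V_y(z)\right]\ (y\in Y^o,\xi\in E_y).$$ Mirror Descent. Applied to a vector field $g:Y\to E_y$ with stepsizes $\gamma_\tau>0$, it is the recurrence $y_1=y_\omega$, $y_{\tau+1}=\mathrm{Prox}_{y_\tau}(\gamma_\tau g(y_\tau))$, $\tau=1,2,\dots$. (The prox-mapping takes values in $Y^o$, so the recurrence is well defined.) *)

theory Defs
  imports "HOL-Analysis.Analysis"
begin

text \<open>
  Functions with domain \<open>X\<close> or \<open>Y\<close> are total HOL functions of which only the values on the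
  set matter. Every \<open>max\<close>/\<open>min\<close> below is of a continuous function over a nonempty compact
  set, so it is attained and equals the \<open>SUP\<close>/\<open>INF\<close> used here.
\<close>

definition is_norm :: "('b::real_vector \<Rightarrow> real) \<Rightarrow> bool" where
  "is_norm N \<longleftrightarrow>
     (\<forall>x. N x = 0 \<longleftrightarrow> x = 0) \<and>
     (\<forall>c x. N (c *\<^sub>R x) = \<bar>c\<bar> * N x) \<and>
     (\<forall>x y. N (x + y) \<le> N x + N y)"

definition conjugate_norm :: "('b::euclidean_space \<Rightarrow> real) \<Rightarrow> 'b \<Rightarrow> real" where
  "conjugate_norm N \<xi> = (SUP y\<in>{y. N y \<le> 1}. \<xi> \<bullet> y)"

text \<open>
  Subgradients of \<open>h : Y \<rightarrow> \<real>\<close>; the inequality is required only on \<open>Y\<close>,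
  that is, \<open>h\<close> is regarded as \<open>+\<infinity>\<close> outside \<open>Y\<close>.
\<close>

definition subdifferential :: "'b::euclidean_space set \<Rightarrow> ('b \<Rightarrow> real) \<Rightarrow> 'b \<Rightarrow> 'b set" where
  "subdifferential Y h y = {p. \<forall>z\<in>Y. h z \<ge> h y + p \<bullet> (z - y)}"

definition subdiff_domain :: "'b::euclidean_space set \<Rightarrow> ('b \<Rightarrow> real) \<Rightarrow> 'b set" where
  "subdiff_domain Y h = {y \<in> Y. subdifferential Y h y \<noteq> {}}"


subsection \<open>The primal and dual problems\<close>

definition saddle_fun ::
  "('b \<Rightarrow> 'a) \<Rightarrow> 'a \<Rightarrow> ('b \<Rightarrow> real) \<Rightarrow> 'a::euclidean_space \<Rightarrow> 'b::euclidean_space \<Rightarrow> real" where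
  "saddle_fun A a \<psi> x y = x \<bullet> (A y + a) + \<psi> y"

definition primal_obj ::
  "'b::euclidean_space set \<Rightarrow> ('b \<Rightarrow> 'a) \<Rightarrow> 'a \<Rightarrow> ('b \<Rightarrow> real) \<Rightarrow> 'a::euclidean_space \<Rightarrow> real" where
  "primal_obj Y A a \<psi> x = (INF y\<in>Y. saddle_fun A a \<psi> x y)"

definition dual_obj ::
  "'a::euclidean_space set \<Rightarrow> ('b \<Rightarrow> 'a) \<Rightarrow> 'a \<Rightarrow> ('b \<Rightarrow> real) \<Rightarrow> 'b::euclidean_space \<Rightarrow> real" where
  "dual_obj X A a \<psi> y = (SUP x\<in>X. saddle_fun A a \<psi> x y)"

definition primal_opt ::
  "'a::euclidean_space set \<Rightarrow> 'b::euclidean_space set \<Rightarrow> ('b \<Rightarrow> 'a) \<Rightarrow> 'a \<Rightarrow> ('b \<Rightarrow> real) \<Rightarrow> real" where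
  "primal_opt X Y A a \<psi> = (SUP x\<in>X. primal_obj Y A a \<psi> x)"

definition dual_opt ::
  "'a::euclidean_space set \<Rightarrow> 'b::euclidean_space set \<Rightarrow> ('b \<Rightarrow> 'a) \<Rightarrow> 'a \<Rightarrow> ('b \<Rightarrow> real) \<Rightarrow> real" where
  "dual_opt X Y A a \<psi> = (INF y\<in>Y. dual_obj X A a \<psi> y)"

definition dual_field ::
  "('a::euclidean_space \<Rightarrow> 'a) \<Rightarrow> ('b \<Rightarrow> 'a) \<Rightarrow> 'a \<Rightarrow> ('b \<Rightarrow> 'b) \<Rightarrow> 'b::euclidean_space \<Rightarrow> 'b" where
  "dual_field xX A a \<psi>' y = adjoint A (xX (A y + a)) + \<psi>' y"


subsection \<open>Proximal setup\<close>

definition distance_generating ::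
  "('b \<Rightarrow> real) \<Rightarrow> 'b::euclidean_space set \<Rightarrow> ('b \<Rightarrow> real) \<Rightarrow> ('b \<Rightarrow> 'b) \<Rightarrow> bool" where
  "distance_generating N Y \<omega> \<omega>' \<longleftrightarrow>
     continuous_on Y \<omega> \<and> convex_on Y \<omega> \<and>
     (\<forall>y\<in>subdiff_domain Y \<omega>. \<omega>' y \<in> subdifferential Y \<omega> y) \<and>
     continuous_on (subdiff_domain Y \<omega>) \<omega>' \<and>
     (\<forall>y\<in>subdiff_domain Y \<omega>. \<forall>z\<in>subdiff_domain Y \<omega>.
        (\<omega>' y - \<omega>' z) \<bullet> (y - z) \<ge> (N (y - z))\<^sup>2)"

definition prox_radius :: "'b::euclidean_space set \<Rightarrow> ('b \<Rightarrow> real) \<Rightarrow> real" where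
  "prox_radius Y \<omega> = sqrt (2 * ((SUP y\<in>Y. \<omega> y) - (INF y\<in>Y. \<omega> y)))"

text \<open>
  For a distance-generating \<open>\<omega>\<close> on a nonempty convex compact \<open>Y\<close> the minimizers selected by
  \<^const>\<open>arg_min_on\<close> below exist and are unique.
\<close>

definition prox_center :: "'b::euclidean_space set \<Rightarrow> ('b \<Rightarrow> real) \<Rightarrow> 'b" where
  "prox_center Y \<omega> = arg_min_on \<omega> Y"

definition bregman :: "('b \<Rightarrow> real) \<Rightarrow> ('b \<Rightarrow> 'b) \<Rightarrow> 'b::euclidean_space \<Rightarrow> 'b \<Rightarrow> real" where
  "bregman \<omega> \<omega>' y z = \<omega> z - \<omega> y - \<omega>' y \<bullet> (z - y)"

definition prox_map ::
  "'b::euclidean_space set \<Rightarrow> ('b \<Rightarrow> real) \<Rightarrow> ('b \<Rightarrow> 'b) \<Rightarrow> 'b \<Rightarrow> 'b \<Rightarrow> 'b" where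
  "prox_map Y \<omega> \<omega>' y \<xi> = arg_min_on (\<lambda>z. \<xi> \<bullet> z + bregman \<omega> \<omega>' y z) Y"


subsection \<open>Mirror Descent\<close>

text \<open>
  \<open>y\<close> is a trajectory of \<open>t\<close> steps of Mirror Descent for the vector field \<open>g\<close> and the
  (positive) stepsizes \<open>\<gamma>\<close>; only \<open>\<gamma> 1, \<dots>, \<gamma> t\<close> and \<open>y 1, \<dots>, y (t + 1)\<close> are constrained.
\<close>

definition mirror_descent ::
  "'b::euclidean_space set \<Rightarrow> ('b \<Rightarrow> real) \<Rightarrow> ('b \<Rightarrow> 'b) \<Rightarrow> ('b \<Rightarrow> 'b) \<Rightarrow> nat \<Rightarrow>
   (nat \<Rightarrow> real) \<Rightarrow> (nat \<Rightarrow> 'b) \<Rightarrow> bool" where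
  "mirror_descent Y \<omega> \<omega>' g t \<gamma> y \<longleftrightarrow>
     y 1 = prox_center Y \<omega> \<and>
     (\<forall>\<tau>\<in>{1..t}. \<gamma> \<tau> > 0 \<and> y (\<tau> + 1) = prox_map Y \<omega> \<omega>' (y \<tau>) (\<gamma> \<tau> *\<^sub>R g (y \<tau>)))"

text \<open>
  The stepsize rule below, together with the positivity of stepsizes in
  \<^const>\<open>mirror_descent\<close>, excludes the case \<open>prox_radius Y \<omega> = 0\<close> (\<open>Y\<close> a singleton), in
  which the stepsizes would vanish and the weights would be \<open>0 / 0\<close>.
\<close>

definition normalized_mirror_descent ::
  "('b \<Rightarrow> real) \<Rightarrow> 'b::euclidean_space set \<Rightarrow> ('b \<Rightarrow> real) \<Rightarrow> ('b \<Rightarrow> 'b) \<Rightarrow> ('b \<Rightarrow> 'b) \<Rightarrow> nat \<Rightarrow>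
   (nat \<Rightarrow> real) \<Rightarrow> (nat \<Rightarrow> 'b) \<Rightarrow> bool" where
  "normalized_mirror_descent N Y \<omega> \<omega>' g t \<gamma> y \<longleftrightarrow>
     mirror_descent Y \<omega> \<omega>' g t \<gamma> y \<and>
     (\<forall>\<tau>\<in>{1..t}. g (y \<tau>) \<noteq> 0 \<and>
        \<gamma> \<tau> = prox_radius Y \<omega> / (sqrt (real t) * conjugate_norm N (g (y \<tau>))))"

definition step_weight :: "(nat \<Rightarrow> real) \<Rightarrow> nat \<Rightarrow> nat \<Rightarrow> real" where
  "step_weight \<gamma> t \<tau> = \<gamma> \<tau> / (\<Sum>s=1..t. \<gamma> s)"

definition primal_approx ::
  "('a \<Rightarrow> 'a) \<Rightarrow> ('b \<Rightarrow> 'a) \<Rightarrow> 'a \<Rightarrow> (nat \<Rightarrow> real) \<Rightarrow> (nat \<Rightarrow> 'b) \<Rightarrow> nat \<Rightarrow> 'a::euclidean_space" where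
  "primal_approx xX A a \<gamma> y t = (\<Sum>\<tau>=1..t. step_weight \<gamma> t \<tau> *\<^sub>R xX (A (y \<tau>) + a))"

definition dual_approx :: "(nat \<Rightarrow> real) \<Rightarrow> (nat \<Rightarrow> 'b) \<Rightarrow> nat \<Rightarrow> 'b::euclidean_space" where
  "dual_approx \<gamma> y t = (\<Sum>\<tau>=1..t. step_weight \<gamma> t \<tau> *\<^sub>R y \<tau>)"

end

theory Submission
  imports Defs
begin

text \<open>
  Write \<open>\<phi> x y = x \<bullet> (A y + a) + \<psi> y\<close> and let \<open>x(y)\<close> be the selected maximizer of
  \<open>\<lambda>x. \<phi> x y\<close>.  The vector \<open>f' y\<close> is a subgradient at \<open>y\<close> of the function \<open>\<lambda>z. \<phi> (x(y)) z\<close>, in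
  which \<open>x(y)\<close> stays fixed.  Hence \<open>\<phi> x (y\<^sub>\<tau>) - \<phi> (x(y\<^sub>\<tau>)) z\<close> is at
  most \<open>f' (y\<^sub>\<tau>) \<bullet> (y\<^sub>\<tau> - z)\<close> for all \<open>x\<close> and \<open>z\<close>, and averaging over \<open>\<tau>\<close>, with \<open>\<phi>\<close> affine in \<open>x\<close>
  and convex in \<open>y\<close>, bounds the duality gap of the averaged points by the weighted regret of the
  trajectory (\<open>duality_gap_le_regret\<close>).

  The regret of Mirror Descent, for any vector field, is at most half the sum of the squared prox
  radius and the squared conjugate norms of the scaled steps (\<open>mirror_descent_regret\<close>): one prox
  step costs a telescoping difference of Bregman distances plus an error that strong convexity of
  \<open>\<omega>\<close> controls.  Two facts about \<open>\<omega>\<close> carry this.  The selection \<open>\<omega>'\<close> is maximal among the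
  subgradients in every feasible direction (\<open>selected_subgrad_maximal\<close>), which gives the
  first-order condition for the prox-mapping; and the Bregman distance is at least half the
  squared norm (\<open>bregman_ge_half_square\<close>).  Both come from moving along segments into the relative
  interior of \<open>Y\<close>, where subgradients exist (\<open>rel_interior_subset_subdiff_domain\<close>).

  The sum of the two optimality gaps equals the duality gap plus the difference of the optimal
  values of (D) and (P), so the nontrivial half of the minimax equality is needed as well.  It follows from the same
  regret bound: constant steps \<open>1 / sqrt t\<close> drive the duality gap to zero (\<open>strong_duality\<close>).
\<close>


section \<open>Norms and their conjugates\<close>

lemma is_norm_zero: "is_norm N \<Longrightarrow> N 0 = 0"
  unfolding is_norm_def by blast

lemma is_norm_scaleR: "is_norm N \<Longrightarrow> N (c *\<^sub>R x) = \<bar>c\<bar> * N x"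
  unfolding is_norm_def by blast

lemma is_norm_nonneg:
  assumes "is_norm N"
  shows "N x \<ge> 0"
proof -
  have "N (x + (-1) *\<^sub>R x) \<le> N x + N ((-1) *\<^sub>R x)"
    using assms unfolding is_norm_def by blast
  then show ?thesis
    unfolding is_norm_scaleR[OF assms] using is_norm_zero[OF assms] by simp
qed

lemma is_norm_convex_on:
  assumes "is_norm N"
  shows "convex_on UNIV N"
proof (rule convex_onI)
  fix t :: real and x y
  assume "0 < t" "t < 1"
  then show "N ((1 - t) *\<^sub>R x + t *\<^sub>R y) \<le> (1 - t) * N x + t * N y"
    using assms unfolding is_norm_def by (smt (verit, best))
qed simp

lemma is_norm_continuous_on:
  fixes N :: "'b::euclidean_space \<Rightarrow> real"
  assumes "is_norm N"
  shows "continuous_on S N"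
  using convex_on_continuous[OF open_UNIV is_norm_convex_on[OF assms]] continuous_on_subset
  by blast

text \<open>
  The minimum of \<open>N\<close> over the compact Euclidean unit sphere is positive; this is what makes
  the supremum in the conjugate norm finite.
\<close>

lemma is_norm_lower_bound:
  fixes N :: "'b::euclidean_space \<Rightarrow> real"
  assumes N: "is_norm N"
  shows "\<exists>c>0. \<forall>x. c * norm x \<le> N x"
proof -
  have "sphere (0::'b) 1 \<noteq> {}"
    by simp
  then obtain m where m: "m \<in> sphere (0::'b) 1" "\<And>x. x \<in> sphere 0 1 \<Longrightarrow> N m \<le> N x"
    using continuous_attains_inf[OF compact_sphere _ is_norm_continuous_on[OF N]] by meson
  have "N m > 0"
    using m(1) N is_norm_nonneg[OF N, of m] unfolding is_norm_def
    by (metis less_eq_real_def norm_eq_zero dist_0_norm mem_sphere zero_neq_one)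
  moreover have "N m * norm x \<le> N x" for x
  proof (cases "x = 0")
    case False
    have "N x = norm x * N ((1 / norm x) *\<^sub>R x)"
      using N False unfolding is_norm_def by simp
    moreover have "N m \<le> N ((1 / norm x) *\<^sub>R x)"
      using False by (intro m(2)) simp
    ultimately show ?thesis
      by (metis mult.commute mult_left_mono norm_ge_zero)
  qed (use is_norm_nonneg[OF N] in simp)
  ultimately show ?thesis by blast
qed

lemma conjugate_norm_bdd_above:
  fixes N :: "'b::euclidean_space \<Rightarrow> real"
  assumes "is_norm N"
  shows "bdd_above ((\<lambda>y. \<xi> \<bullet> y) ` {y. N y \<le> 1})"
proof -
  obtain c where c: "c > 0" "\<And>x. c * norm x \<le> N x"
    using is_norm_lower_bound[OF assms] by blast
  have "\<xi> \<bullet> y \<le> norm \<xi> * (1 / c)" if "N y \<le> 1" for y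
  proof -
    have "norm y \<le> 1 / c"
      using c(1) c(2)[of y] that by (simp add: field_simps)
    then show ?thesis
      using norm_cauchy_schwarz[of \<xi> y] by (smt (verit) mult_left_mono norm_ge_zero)
  qed
  then show ?thesis by (intro bdd_aboveI[where M = "norm \<xi> * (1 / c)"]) auto
qed

lemma inner_le_conjugate_norm:
  fixes N :: "'b::euclidean_space \<Rightarrow> real"
  assumes N: "is_norm N"
  shows "\<xi> \<bullet> y \<le> conjugate_norm N \<xi> * N y"
proof (cases "y = 0")
  case True
  then show ?thesis using is_norm_zero[OF N] by simp
next
  case False
  then have pos: "N y > 0"
    using N is_norm_nonneg[OF N, of y] unfolding is_norm_def by (metis less_eq_real_def)
  then have "N ((1 / N y) *\<^sub>R y) \<le> 1"
    using N unfolding is_norm_def by simp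
  then have "\<xi> \<bullet> ((1 / N y) *\<^sub>R y) \<le> conjugate_norm N \<xi>"
    unfolding conjugate_norm_def by (intro cSUP_upper conjugate_norm_bdd_above[OF N]) simp
  then show ?thesis using pos by (simp add: field_simps)
qed

lemma conjugate_norm_nonneg:
  fixes N :: "'b::euclidean_space \<Rightarrow> real"
  assumes N: "is_norm N"
  shows "conjugate_norm N \<xi> \<ge> 0"
proof -
  have "N 0 \<le> 1" using is_norm_zero[OF N] by simp
  then have "\<xi> \<bullet> 0 \<le> conjugate_norm N \<xi>"
    unfolding conjugate_norm_def by (intro cSUP_upper conjugate_norm_bdd_above[OF N]) simp
  then show ?thesis by simp
qed

lemma conjugate_norm_pos:
  fixes N :: "'b::euclidean_space \<Rightarrow> real"
  assumes N: "is_norm N" and "\<xi> \<noteq> 0"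
  shows "conjugate_norm N \<xi> > 0"
proof -
  have "0 < \<xi> \<bullet> \<xi>" using assms by simp
  also have "\<dots> \<le> conjugate_norm N \<xi> * N \<xi>" by (rule inner_le_conjugate_norm[OF N])
  finally show ?thesis
    using conjugate_norm_nonneg[OF N, of \<xi>] by (metis less_eq_real_def mult_zero_left order_less_irrefl)
qed


section \<open>Subgradients of convex functions on a convex compact set\<close>

text \<open>
  On a short segment towards \<open>z\<close> the quadratic error is of higher order than the other
  terms, so convexity lets one discard it.  Applied to a minimizer of \<open>h\<close> plus a linear or
  quadratic function, this is Fermat's rule together with the sum rule.
\<close>

lemma subgradient_of_quadratic_minorant:
  fixes h :: "'b::euclidean_space \<Rightarrow> real"
  assumes h: "convex_on Y h" and u: "u \<in> Y"
    and min: "\<And>z. z \<in> Y \<Longrightarrow> h u \<le> h z + d \<bullet> (z - u) + c * (norm (z - u))\<^sup>2"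
  shows "- d \<in> subdifferential Y h u"
  unfolding subdifferential_def
proof (intro CollectI ballI)
  fix z assume z: "z \<in> Y"
  define r where "r = h z - h u + d \<bullet> (z - u)"
  define K where "K = c * (norm (z - u))\<^sup>2"
  have "- r \<le> \<theta> * K" if \<theta>: "0 < \<theta>" "\<theta> < 1" for \<theta> :: real
  proof -
    let ?w = "(1 - \<theta>) *\<^sub>R u + \<theta> *\<^sub>R z"
    have w: "?w \<in> Y" "?w - u = \<theta> *\<^sub>R (z - u)"
      using h u z \<theta> by (auto simp: convex_on_def convex_alt algebra_simps)
    have "h u \<le> h ?w + d \<bullet> (?w - u) + c * (norm (?w - u))\<^sup>2"
      by (rule min[OF w(1)])
    also have "\<dots> = h ?w + \<theta> * (d \<bullet> (z - u)) + \<theta> * (\<theta> * K)"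
      unfolding w(2) K_def by (simp add: power_mult_distrib power2_eq_square)
    also have "\<dots> \<le> (1 - \<theta>) * h u + \<theta> * h z + \<theta> * (d \<bullet> (z - u)) + \<theta> * (\<theta> * K)"
      using convex_onD[OF h, of \<theta> u z] u z \<theta> by simp
    finally have "0 \<le> \<theta> * (r + \<theta> * K)"
      unfolding r_def by (simp add: algebra_simps)
    then show ?thesis using \<theta> by (simp add: zero_le_mult_iff)
  qed
  then have "eventually (\<lambda>\<theta>. - r \<le> \<theta> * K) (at_right 0)"
    unfolding eventually_at_right_field by (intro exI[of _ 1]) auto
  moreover have "((\<lambda>\<theta>. \<theta> * K) \<longlongrightarrow> 0 * K) (at_right 0)"
    by (intro tendsto_intros)
  ultimately have "- r \<le> 0 * K"
    by (intro tendsto_lowerbound) auto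
  then show "h u + - d \<bullet> (z - u) \<le> h z"
    unfolding r_def by simp
qed

text \<open>
  The minimizer \<open>u\<close> of \<open>h z + k * (norm (z - y))\<^sup>2\<close> carries the subgradient \<open>2 * k * (y - u)\<close>.
  Testing it at the point of \<open>Y\<close> that lies a distance \<open>e\<close> beyond \<open>y\<close>, in the direction from
  \<open>u\<close> to \<open>y\<close>, bounds its length by the oscillation of \<open>h\<close> over \<open>e\<close>, uniformly in \<open>k\<close>.
\<close>

lemma penalty_minimizer_subgradient:
  fixes h :: "'b::euclidean_space \<Rightarrow> real"
  assumes Y: "compact Y" and h: "convex_on Y h" "continuous_on Y h"
    and y: "y \<in> Y" and e: "e > 0" "cball y e \<inter> affine hull Y \<subseteq> Y"
    and M: "\<And>z. z \<in> Y \<Longrightarrow> \<bar>h z\<bar> \<le> M" and k: "k > 0"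
  shows "\<exists>u p. u \<in> Y \<and> p \<in> subdifferential Y h u \<and> e * norm p \<le> 2 * M \<and>
    norm (u - y) \<le> M / e / k"
proof -
  have "Y \<noteq> {}" using y by auto
  moreover have "continuous_on Y (\<lambda>z. h z + k * (norm (z - y))\<^sup>2)"
    by (intro continuous_intros h)
  ultimately obtain u where u: "u \<in> Y"
    "\<And>z. z \<in> Y \<Longrightarrow> h u + k * (norm (u - y))\<^sup>2 \<le> h z + k * (norm (z - y))\<^sup>2"
    using continuous_attains_inf[OF Y] by blast
  define p where "p = (2 * k) *\<^sub>R (y - u)"
  have "- ((2 * k) *\<^sub>R (u - y)) \<in> subdifferential Y h u"
  proof (rule subgradient_of_quadratic_minorant[OF h(1) u(1), where c = k])
    fix z assume z: "z \<in> Y"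
    have "k * (norm (z - y))\<^sup>2 - k * (norm (u - y))\<^sup>2
        = (2 * k) *\<^sub>R (u - y) \<bullet> (z - u) + k * (norm (z - u))\<^sup>2"
      by (simp add: power2_norm_eq_inner inner_diff_left inner_diff_right inner_commute algebra_simps)
    then show "h u \<le> h z + (2 * k) *\<^sub>R (u - y) \<bullet> (z - u) + k * (norm (z - u))\<^sup>2"
      using u(2)[OF z] by linarith
  qed
  then have p: "p \<in> subdifferential Y h u"
    unfolding p_def by (simp add: algebra_simps)
  have np: "norm p = 2 * k * norm (y - u)"
    unfolding p_def using k by simp
  have bound: "e * norm p \<le> 2 * M"
  proof (cases "u = y")
    case True
    then show ?thesis using M[OF y] np by simp
  next
    case False
    define s where "s = e / norm (y - u)"
    have s: "s > 0" "s * norm (y - u) = e"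
      unfolding s_def using e(1) False by auto
    define w where "w = y + s *\<^sub>R (y - u)"
    have "w = (1 + s) *\<^sub>R y + (- s) *\<^sub>R u"
      unfolding w_def by (simp add: algebra_simps)
    then have "w \<in> affine hull Y"
      using y u(1) by (metis add_diff_cancel_right' affine_affine_hull diff_add_cancel hull_inc mem_affine
          uminus_add_conv_diff add.commute)
    moreover have "w \<in> cball y e"
      unfolding w_def using s by (simp add: dist_norm)
    ultimately have w: "w \<in> Y" using e(2) by blast
    have "p \<bullet> (w - u) = norm p * norm (y - u) + e * norm p"
    proof -
      have "w - u = (1 + s) *\<^sub>R (y - u)"
        unfolding w_def by (simp add: algebra_simps)
      then have "p \<bullet> (w - u) = 2 * k * (1 + s) * (norm (y - u))\<^sup>2"
        unfolding p_def by (simp add: power2_norm_eq_inner)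
      also have "\<dots> = norm p * norm (y - u) + norm p * (s * norm (y - u))"
        unfolding np by (simp add: power2_eq_square algebra_simps)
      finally show ?thesis using s(2) by simp
    qed
    moreover have "h w \<ge> h u + p \<bullet> (w - u)"
      using p w unfolding subdifferential_def by blast
    moreover have "norm p * norm (y - u) \<ge> 0" by simp
    ultimately show ?thesis
      using M[OF w] M[OF u(1)] by linarith
  qed
  moreover have "norm (u - y) \<le> M / e / k"
    using bound e(1) k unfolding np by (simp add: field_simps norm_minus_commute)
  ultimately show ?thesis using u(1) p by blast
qed

text \<open>
  As the penalty grows, the minimizers converge to \<open>y\<close>, and a limit point of their bounded
  subgradients is a subgradient at \<open>y\<close>.
\<close>

lemma rel_interior_subset_subdiff_domain:
  fixes h :: "'b::euclidean_space \<Rightarrow> real"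
  assumes Y: "compact Y" and h: "convex_on Y h" "continuous_on Y h"
  shows "rel_interior Y \<subseteq> subdiff_domain Y h"
proof
  fix y assume "y \<in> rel_interior Y"
  then obtain e where y: "y \<in> Y" and e: "e > 0" "cball y e \<inter> affine hull Y \<subseteq> Y"
    unfolding mem_rel_interior_cball by blast
  have "bounded (h ` Y)"
    using compact_continuous_image[OF h(2) Y] compact_imp_bounded by blast
  then obtain M where M: "\<And>z. z \<in> Y \<Longrightarrow> \<bar>h z\<bar> \<le> M"
    unfolding bounded_iff by force
  have "\<forall>n. \<exists>u p. u \<in> Y \<and> p \<in> subdifferential Y h u \<and> e * norm p \<le> 2 * M \<and>
      norm (u - y) \<le> M / e / real (Suc n)"
    by (intro allI penalty_minimizer_subgradient[OF Y h y e M]) auto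
  then obtain u p where up: "\<And>n. u n \<in> Y" "\<And>n. p n \<in> subdifferential Y h (u n)"
    "\<And>n. e * norm (p n) \<le> 2 * M" "\<And>n. norm (u n - y) \<le> M / e / real (Suc n)"
    by metis
  have "(\<lambda>n. M / e / real (Suc n)) \<longlonglongrightarrow> 0"
    by (intro tendsto_divide_0[OF tendsto_const] filterlim_compose[OF filterlim_real_sequentially]
        filterlim_at_top_imp_at_infinity filterlim_Suc)
  then have "(\<lambda>n. u n - y) \<longlonglongrightarrow> 0"
    by (rule Lim_null_comparison[OF always_eventually[OF allI[OF up(4)]]])
  then have u_lim: "u \<longlonglongrightarrow> y"
    using LIM_zero_iff by blast
  have "bounded (range p)"
    unfolding bounded_iff using up(3) e(1)
    by (intro exI[of _ "2 * M / e"]) (auto simp: field_simps)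
  then obtain q r where r: "strict_mono (r :: nat \<Rightarrow> nat)" "(p \<circ> r) \<longlonglongrightarrow> q"
    using bounded_imp_convergent_subsequence[of p] by blast
  have ur: "(\<lambda>n. u (r n)) \<longlonglongrightarrow> y"
    using LIMSEQ_subseq_LIMSEQ[OF u_lim r(1)] by (simp add: o_def)
  have hur: "(\<lambda>n. h (u (r n))) \<longlonglongrightarrow> h y"
    using continuous_on_tendsto_compose[OF h(2) ur y] up(1) by simp
  have "h y + q \<bullet> (z - y) \<le> h z" if z: "z \<in> Y" for z
  proof (rule tendsto_upperbound)
    show "(\<lambda>n. h (u (r n)) + p (r n) \<bullet> (z - u (r n))) \<longlonglongrightarrow> h y + q \<bullet> (z - y)"
      using r(2) unfolding o_def by (intro tendsto_intros hur ur)
    show "\<forall>\<^sub>F n in sequentially. h (u (r n)) + p (r n) \<bullet> (z - u (r n)) \<le> h z"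
      using up(2) z unfolding subdifferential_def by (intro always_eventually) blast
  qed simp
  then show "y \<in> subdiff_domain Y h"
    unfolding subdiff_domain_def subdifferential_def using y by blast
qed


section \<open>Bregman distances and the prox-mapping\<close>

lemma arg_min_on_compact:
  fixes f :: "'b::euclidean_space \<Rightarrow> real"
  assumes "compact S" "S \<noteq> {}" "continuous_on S f"
  shows "arg_min_on f S \<in> S" and "z \<in> S \<Longrightarrow> f (arg_min_on f S) \<le> f z"
proof -
  have "\<exists>x. is_arg_min f (\<lambda>x. x \<in> S) x"
    using continuous_attains_inf[OF assms] unfolding is_arg_min_linorder by blast
  then have "is_arg_min f (\<lambda>x. x \<in> S) (arg_min_on f S)"
    unfolding arg_min_on_def arg_min_def by (rule someI_ex)
  then show "arg_min_on f S \<in> S" "z \<in> S \<Longrightarrow> f (arg_min_on f S) \<le> f z"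
    unfolding is_arg_min_linorder by auto
qed

text \<open>
  Split the unit interval into \<open>n\<close> equal pieces: each loses at most \<open>C / n\<^sup>2\<close>, hence all of them
  together at most \<open>C / n\<close>, and \<open>n\<close> is arbitrary.  This does the work of integrating a
  derivative of \<open>m\<close>.
\<close>

lemma endpoint_le_of_quadratic_decrease:
  fixes m :: "real \<Rightarrow> real"
  assumes m: "\<And>s t. 0 \<le> s \<Longrightarrow> s \<le> t \<Longrightarrow> t \<le> 1 \<Longrightarrow> m s - C * (t - s)\<^sup>2 \<le> m t"
  shows "m 0 \<le> m 1"
proof (rule tendsto_upperbound)
  show "(\<lambda>n. m 0 - C / real n) \<longlonglongrightarrow> m 0"
    using tendsto_diff[OF tendsto_const lim_const_over_n, of "m 0" C] by simp
  have "m 0 - C / real n \<le> m 1" if n: "n > 0" for n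
  proof -
    have "i \<le> n \<Longrightarrow> m 0 - real i * (C / (real n)\<^sup>2) \<le> m (real i / real n)" for i
    proof (induction i)
      case (Suc i)
      have "m (real i / real n) - C * (real (Suc i) / real n - real i / real n)\<^sup>2
          \<le> m (real (Suc i) / real n)"
        using Suc.prems n by (intro m) (auto simp: field_simps)
      moreover have "real (Suc i) / real n - real i / real n = 1 / real n"
        by (simp add: diff_divide_distrib[symmetric])
      ultimately have "m (real i / real n) - C / (real n)\<^sup>2 \<le> m (real (Suc i) / real n)"
        by (simp add: power_divide)
      then show ?case
        using Suc by (simp add: algebra_simps add_divide_distrib)
    qed simp
    from this[of n] show ?thesis
      using n by (simp add: power2_eq_square)
  qed
  then show "\<forall>\<^sub>F n in sequentially. m 0 - C / real n \<le> m 1"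
    unfolding eventually_sequentially by (intro exI[of _ 1]) auto
qed simp

locale proximal_setup =
  fixes N :: "'b::euclidean_space \<Rightarrow> real" and Y :: "'b set"
    and \<omega> :: "'b \<Rightarrow> real" and \<omega>' :: "'b \<Rightarrow> 'b"
  assumes Y: "Y \<noteq> {}" "convex Y" "compact Y"
    and norm: "is_norm N"
    and dgf: "distance_generating N Y \<omega> \<omega>'"
begin

abbreviation Yo :: "'b set" where
  "Yo \<equiv> subdiff_domain Y \<omega>"

lemma continuous_dgf: "continuous_on Y \<omega>"
  and convex_dgf: "convex_on Y \<omega>"
  and continuous_dgf_subgrad: "continuous_on Yo \<omega>'"
  using dgf unfolding distance_generating_def by blast+

lemma dgf_subgrad: "\<lbrakk>y \<in> Yo; z \<in> Y\<rbrakk> \<Longrightarrow> \<omega> y + \<omega>' y \<bullet> (z - y) \<le> \<omega> z"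
  using dgf unfolding distance_generating_def subdifferential_def by blast

lemma dgf_strongly_monotone:
  "\<lbrakk>y \<in> Yo; z \<in> Yo\<rbrakk> \<Longrightarrow> (N (y - z))\<^sup>2 \<le> (\<omega>' y - \<omega>' z) \<bullet> (y - z)"
  using dgf unfolding distance_generating_def by blast

lemma subdiff_domain_subset: "y \<in> Yo \<Longrightarrow> y \<in> Y"
  unfolding subdiff_domain_def by blast

lemma segment_to_rel_interior:
  assumes "y \<in> Y" "z \<in> rel_interior Y" "0 < s" "s \<le> 1"
  shows "y + s *\<^sub>R (z - y) \<in> Yo"
proof -
  have "y - s *\<^sub>R (y - z) \<in> rel_interior Y"
    using assms Y(2) by (intro rel_interior_convex_shrink)
  moreover have "y - s *\<^sub>R (y - z) = y + s *\<^sub>R (z - y)"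
    by (simp add: algebra_simps)
  ultimately show ?thesis
    using rel_interior_subset_subdiff_domain[OF Y(3) convex_dgf continuous_dgf] by auto
qed

lemma ge_on_Y_of_ge_on_rel_interior:
  fixes f :: "'b \<Rightarrow> real"
  assumes "continuous_on Y f" "\<And>z. z \<in> rel_interior Y \<Longrightarrow> c \<le> f z" "z \<in> Y"
  shows "c \<le> f z"
proof -
  have "closure (rel_interior Y) = Y"
    using convex_closure_rel_interior[OF Y(2)] compact_imp_closed[OF Y(3)] by simp
  then show ?thesis
    using continuous_ge_on_closure[of "rel_interior Y" f z c] assms by simp
qed

text \<open>
  Monotonicity makes subgradients at points \<open>y + s *\<^sub>R (z - y)\<close> dominate \<open>p\<close> in the direction
  \<open>z - y\<close>, and by continuity of \<open>\<omega>'\<close> they tend to \<open>\<omega>' y\<close> as \<open>s\<close> decreases to \<open>0\<close>.  Minimality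
  of a point only provides some subgradient there; this lemma turns it into an inequality
  for \<open>\<omega>'\<close>.
\<close>

lemma selected_subgrad_maximal:
  assumes y: "y \<in> Y" and p: "p \<in> subdifferential Y \<omega> y" and z: "z \<in> Y"
  shows "p \<bullet> (z - y) \<le> \<omega>' y \<bullet> (z - y)"
proof -
  have yo: "y \<in> Yo" using y p unfolding subdiff_domain_def by blast
  have "0 \<le> (\<omega>' y - p) \<bullet> (z - y)" if z: "z \<in> rel_interior Y" for z
  proof -
    define w where "w s = y + s *\<^sub>R (z - y)" for s :: real
    have w: "w s \<in> Yo" if "0 < s" "s \<le> 1" for s
      unfolding w_def using segment_to_rel_interior[OF y z that] .
    have "0 \<le> (\<omega>' (w s) - p) \<bullet> (z - y)" if s: "0 < s" "s \<le> 1" for s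
    proof -
      have "\<omega> (w s) + \<omega>' (w s) \<bullet> (y - w s) \<le> \<omega> y" "\<omega> y + p \<bullet> (w s - y) \<le> \<omega> (w s)"
        using dgf_subgrad[OF w[OF s] y] p subdiff_domain_subset[OF w[OF s]]
        unfolding subdifferential_def by auto
      then have "0 \<le> s * ((\<omega>' (w s) - p) \<bullet> (z - y))"
        unfolding w_def by (simp add: algebra_simps)
      then show ?thesis using s by (simp add: zero_le_mult_iff)
    qed
    then have ev: "\<forall>\<^sub>F n in sequentially. 0 \<le> (\<omega>' (w (1 / real n)) - p) \<bullet> (z - y)"
      unfolding eventually_sequentially by (intro exI[of _ 1]) auto
    have "(\<lambda>n. w (1 / real n)) \<longlonglongrightarrow> y + 0 *\<^sub>R (z - y)"
      unfolding w_def by (intro tendsto_intros lim_const_over_n)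
    then have "(\<lambda>n. \<omega>' (w (1 / real n))) \<longlonglongrightarrow> \<omega>' y"
      using w by (intro continuous_on_tendsto_compose[OF continuous_dgf_subgrad _ yo])
        (auto simp: eventually_sequentially intro!: exI[of _ 1])
    then have "(\<lambda>n. (\<omega>' (w (1 / real n)) - p) \<bullet> (z - y)) \<longlonglongrightarrow> (\<omega>' y - p) \<bullet> (z - y)"
      by (intro tendsto_intros)
    then show ?thesis
      using ev by (rule tendsto_lowerbound) simp
  qed
  then have "0 \<le> (\<omega>' y - p) \<bullet> (z - y)"
    by (intro ge_on_Y_of_ge_on_rel_interior[OF _ _ z, of "\<lambda>z. (\<omega>' y - p) \<bullet> (z - y)"]
        continuous_intros)
  then show ?thesis by (simp add: inner_diff_left)
qed

text \<open>
  For \<open>z\<close> in the relative interior the segment from \<open>y\<close> to \<open>z\<close> stays in \<open>Yo\<close>, where the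
  strong monotonicity bounds the growth of \<open>\<omega>\<close>; the general case follows by density.
\<close>

lemma bregman_ge_half_square:
  assumes y: "y \<in> Yo" and z: "z \<in> Y"
  shows "(N (z - y))\<^sup>2 / 2 \<le> bregman \<omega> \<omega>' y z"
proof -
  have "0 \<le> bregman \<omega> \<omega>' y z - (N (z - y))\<^sup>2 / 2" if z: "z \<in> rel_interior Y" for z
  proof -
    define D where "D = (N (z - y))\<^sup>2"
    define w where "w s = y + s *\<^sub>R (z - y)" for s :: real
    define m where "m s = \<omega> (w s) - s * (\<omega>' y \<bullet> (z - y)) - s\<^sup>2 * D / 2" for s
    have wo: "w s \<in> Yo" if "0 \<le> s" "s \<le> 1" for s
      using segment_to_rel_interior[OF subdiff_domain_subset[OF y] z] y that
      unfolding w_def by (cases "s = 0") auto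
    have "m s - D / 2 * (t - s)\<^sup>2 \<le> m t" if st: "0 \<le> s" "s \<le> t" "t \<le> 1" for s t
    proof -
      have ws: "w s \<in> Yo" and wt: "w t \<in> Y"
        using wo st subdiff_domain_subset by auto
      have slope: "\<omega>' y \<bullet> (z - y) + s * D \<le> \<omega>' (w s) \<bullet> (z - y)"
      proof (cases "s = 0")
        case False
        have "s\<^sup>2 * D \<le> s * ((\<omega>' (w s) - \<omega>' y) \<bullet> (z - y))"
          using dgf_strongly_monotone[OF ws y] is_norm_scaleR[OF norm, of s "z - y"]
          unfolding w_def D_def by (simp add: power_mult_distrib)
        then have "s * (s * D) \<le> s * ((\<omega>' (w s) - \<omega>' y) \<bullet> (z - y))"
          by (simp add: power2_eq_square mult.assoc)
        then have "s * D \<le> (\<omega>' (w s) - \<omega>' y) \<bullet> (z - y)"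
          using False st(1) by (simp add: mult_le_cancel_left)
        then show ?thesis by (simp add: inner_diff_left)
      qed (simp add: w_def)
      have "w t - w s = (t - s) *\<^sub>R (z - y)"
        unfolding w_def by (simp add: algebra_simps)
      then have "\<omega> (w s) + (t - s) * (\<omega>' (w s) \<bullet> (z - y)) \<le> \<omega> (w t)"
        using dgf_subgrad[OF ws wt] by simp
      moreover have "(t - s) * (\<omega>' y \<bullet> (z - y) + s * D) \<le> (t - s) * (\<omega>' (w s) \<bullet> (z - y))"
        using slope st by (intro mult_left_mono) auto
      ultimately show ?thesis
        unfolding m_def by (simp add: algebra_simps power2_eq_square add_divide_distrib diff_divide_distrib)
    qed
    then have "m 0 \<le> m 1"
      by (rule endpoint_le_of_quadratic_decrease)
    then show ?thesis
      unfolding m_def w_def D_def bregman_def by simp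
  qed
  moreover have "continuous_on Y (\<lambda>z. bregman \<omega> \<omega>' y z - (N (z - y))\<^sup>2 / 2)"
    unfolding bregman_def
    by (intro continuous_intros continuous_dgf
        continuous_on_compose2[OF is_norm_continuous_on[OF norm, of UNIV]]) auto
  ultimately show ?thesis
    using ge_on_Y_of_ge_on_rel_interior[OF _ _ z] by fastforce
qed

lemma prox_center_in: "prox_center Y \<omega> \<in> Yo"
  and zero_subgrad_prox_center: "0 \<in> subdifferential Y \<omega> (prox_center Y \<omega>)"
proof -
  note min = arg_min_on_compact[OF Y(3,1) continuous_dgf, folded prox_center_def]
  show 0: "0 \<in> subdifferential Y \<omega> (prox_center Y \<omega>)"
    unfolding subdifferential_def using min(2) by simp
  then show "prox_center Y \<omega> \<in> Yo"
    unfolding subdiff_domain_def using min(1) by blast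
qed

lemma dgf_oscillation:
  assumes "y \<in> Y" "z \<in> Y"
  shows "2 * (\<omega> z - \<omega> y) \<le> (prox_radius Y \<omega>)\<^sup>2"
proof -
  have "bounded (\<omega> ` Y)"
    using compact_continuous_image[OF continuous_dgf Y(3)] by (rule compact_imp_bounded)
  then have bdd: "bdd_above (\<omega> ` Y)" "bdd_below (\<omega> ` Y)"
    by (auto intro: bounded_imp_bdd_above bounded_imp_bdd_below)
  have osc: "\<omega> z - \<omega> y \<le> (SUP y\<in>Y. \<omega> y) - (INF y\<in>Y. \<omega> y)" if "y \<in> Y" "z \<in> Y" for y z
    using cSUP_upper[OF that(2) bdd(1)] cINF_lower[OF bdd(2) that(1)] by linarith
  have "(prox_radius Y \<omega>)\<^sup>2 = 2 * ((SUP y\<in>Y. \<omega> y) - (INF y\<in>Y. \<omega> y))"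
    unfolding prox_radius_def using osc[OF assms(1) assms(1)] by simp
  then show ?thesis using osc[OF assms] by simp
qed

lemma bregman_prox_center_le:
  assumes "z \<in> Y"
  shows "bregman \<omega> \<omega>' (prox_center Y \<omega>) z \<le> (prox_radius Y \<omega>)\<^sup>2 / 2"
proof -
  let ?c = "prox_center Y \<omega>"
  have "?c \<in> Y" using prox_center_in subdiff_domain_subset by blast
  then show ?thesis
    using selected_subgrad_maximal[OF _ zero_subgrad_prox_center assms]
      dgf_oscillation[of ?c z] assms unfolding bregman_def by simp
qed

lemma prox_map_subgrad:
  fixes y \<xi> defines "u \<equiv> prox_map Y \<omega> \<omega>' y \<xi>"
  shows "u \<in> Yo" and "\<omega>' y - \<xi> \<in> subdifferential Y \<omega> u"
proof -
  have "continuous_on Y (\<lambda>z. \<xi> \<bullet> z + bregman \<omega> \<omega>' y z)"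
    unfolding bregman_def by (intro continuous_intros continuous_dgf)
  note min = arg_min_on_compact[OF Y(3,1) this, folded prox_map_def, folded u_def]
  have "- (\<xi> - \<omega>' y) \<in> subdifferential Y \<omega> u"
  proof (rule subgradient_of_quadratic_minorant[OF convex_dgf min(1), where c = 0])
    fix z assume "z \<in> Y"
    from min(2)[OF this] show "\<omega> u \<le> \<omega> z + (\<xi> - \<omega>' y) \<bullet> (z - u) + 0 * (norm (z - u))\<^sup>2"
      unfolding bregman_def by (simp add: algebra_simps)
  qed
  then show p: "\<omega>' y - \<xi> \<in> subdifferential Y \<omega> u" by simp
  then show "u \<in> Yo" unfolding subdiff_domain_def using min(1) by blast
qed

text \<open>
  The first-order condition at the new point \<open>u\<close> bounds \<open>\<xi> \<bullet> (u - z)\<close> by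
  \<open>bregman \<omega> \<omega>' y z - bregman \<omega> \<omega>' u z - bregman \<omega> \<omega>' y u\<close>.  The remaining term \<open>\<xi> \<bullet> (y - u)\<close> is at most the product of the conjugate
  norm of \<open>\<xi>\<close> and \<open>N (y - u)\<close>, which strong convexity absorbs into \<open>bregman \<omega> \<omega>' y u\<close>.
\<close>

lemma prox_step:
  fixes y \<xi> defines "u \<equiv> prox_map Y \<omega> \<omega>' y \<xi>"
  assumes y: "y \<in> Yo" and z: "z \<in> Y" and c: "\<And>v. \<xi> \<bullet> v \<le> c * N v"
  shows "\<xi> \<bullet> (y - z) \<le> bregman \<omega> \<omega>' y z - bregman \<omega> \<omega>' u z + c\<^sup>2 / 2"
proof -
  have u: "u \<in> Yo" "\<omega>' y - \<xi> \<in> subdifferential Y \<omega> u"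
    unfolding u_def by (rule prox_map_subgrad)+
  have "(\<omega>' y - \<xi>) \<bullet> (z - u) \<le> \<omega>' u \<bullet> (z - u)"
    using selected_subgrad_maximal[OF subdiff_domain_subset[OF u(1)] u(2) z] .
  then have "\<xi> \<bullet> (u - z) \<le> bregman \<omega> \<omega>' y z - bregman \<omega> \<omega>' u z - bregman \<omega> \<omega>' y u"
    unfolding bregman_def by (simp add: algebra_simps)
  moreover have "\<xi> \<bullet> (y - u) \<le> c * N (y - u)"
    by (rule c)
  moreover have "c * N (y - u) \<le> c\<^sup>2 / 2 + (N (y - u))\<^sup>2 / 2"
    using sum_squares_bound[of c "N (y - u)"] by simp
  moreover have "N (y - u) = N (u - y)"
    using is_norm_scaleR[OF norm, of "-1" "u - y"] by simp
  moreover have "(N (u - y))\<^sup>2 / 2 \<le> bregman \<omega> \<omega>' y u"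
    by (rule bregman_ge_half_square[OF y subdiff_domain_subset[OF u(1)]])
  moreover have "\<xi> \<bullet> (y - z) = \<xi> \<bullet> (y - u) + \<xi> \<bullet> (u - z)"
    by (simp add: algebra_simps)
  ultimately show ?thesis by (smt (verit))
qed


section \<open>The regret of Mirror Descent\<close>

lemma mirror_descent_in_domain:
  assumes md: "mirror_descent Y \<omega> \<omega>' g t \<gamma> y" and "\<tau> \<in> {1..t + 1}"
  shows "y \<tau> \<in> Yo"
proof (cases "\<tau> = 1")
  case True
  then show ?thesis
    using md prox_center_in unfolding mirror_descent_def by simp
next
  case False
  then obtain \<sigma> where "\<tau> = \<sigma> + 1" "\<sigma> \<in> {1..t}"
    using assms(2) by (cases \<tau>) auto
  then show ?thesis
    using md prox_map_subgrad(1) unfolding mirror_descent_def by simp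
qed

text \<open>
  Summing the prox steps telescopes the Bregman distances to a fixed \<open>z\<close>; the last one is
  nonnegative and the first one is controlled by the prox radius.
\<close>

lemma mirror_descent_regret:
  assumes md: "mirror_descent Y \<omega> \<omega>' g t \<gamma> y" and z: "z \<in> Y"
  shows "(\<Sum>\<tau>=1..t. \<gamma> \<tau> * (g (y \<tau>) \<bullet> (y \<tau> - z)))
    \<le> ((prox_radius Y \<omega>)\<^sup>2 + (\<Sum>\<tau>=1..t. (\<gamma> \<tau> * conjugate_norm N (g (y \<tau>)))\<^sup>2)) / 2"
proof -
  let ?V = "\<lambda>\<tau>. bregman \<omega> \<omega>' (y \<tau>) z"
  let ?e = "\<lambda>\<tau>. (\<gamma> \<tau> * conjugate_norm N (g (y \<tau>)))\<^sup>2 / 2"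
  have "\<gamma> \<tau> * (g (y \<tau>) \<bullet> (y \<tau> - z)) \<le> ?e \<tau> - (?V (Suc \<tau>) - ?V \<tau>)" if \<tau>: "\<tau> \<in> {1..t}" for \<tau>
  proof -
    have step: "\<gamma> \<tau> > 0" "y (Suc \<tau>) = prox_map Y \<omega> \<omega>' (y \<tau>) (\<gamma> \<tau> *\<^sub>R g (y \<tau>))"
      using md \<tau> unfolding mirror_descent_def by auto
    have "\<gamma> \<tau> *\<^sub>R g (y \<tau>) \<bullet> v \<le> \<gamma> \<tau> * conjugate_norm N (g (y \<tau>)) * N v" for v
      using mult_left_mono[OF inner_le_conjugate_norm[OF norm], of "\<gamma> \<tau>"] step(1)
      by (simp add: mult.assoc)
    moreover have "y \<tau> \<in> Yo"
      using mirror_descent_in_domain[OF md] \<tau> by simp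
    ultimately show ?thesis
      using prox_step[OF _ z, of "y \<tau>" "\<gamma> \<tau> *\<^sub>R g (y \<tau>)"] unfolding step(2) by fastforce
  qed
  then have "(\<Sum>\<tau>=1..t. \<gamma> \<tau> * (g (y \<tau>) \<bullet> (y \<tau> - z)))
      \<le> (\<Sum>\<tau>=1..t. ?e \<tau> - (?V (Suc \<tau>) - ?V \<tau>))"
    by (rule sum_mono)
  also have "\<dots> = (\<Sum>\<tau>=1..t. ?e \<tau>) - (\<Sum>\<tau>=1..t. ?V (Suc \<tau>) - ?V \<tau>)"
    by (rule sum_subtractf)
  also have "(\<Sum>\<tau>=1..t. ?V (Suc \<tau>) - ?V \<tau>) = ?V (Suc t) - ?V 1"
    by (rule sum_Suc_diff) simp
  also have "(\<Sum>\<tau>=1..t. ?e \<tau>) - (?V (Suc t) - ?V 1) \<le> (\<Sum>\<tau>=1..t. ?e \<tau>) + (prox_radius Y \<omega>)\<^sup>2 / 2"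
  proof -
    have "y (Suc t) \<in> Yo" using mirror_descent_in_domain[OF md] by simp
    then have "0 \<le> ?V (Suc t)"
      using bregman_ge_half_square[OF _ z, of "y (Suc t)"] by (smt (verit) zero_le_power2 divide_nonneg_pos)
    moreover have "?V 1 \<le> (prox_radius Y \<omega>)\<^sup>2 / 2"
      using md bregman_prox_center_le[OF z] unfolding mirror_descent_def by simp
    ultimately show ?thesis by linarith
  qed
  finally show ?thesis
    by (simp add: sum_divide_distrib[symmetric] add_divide_distrib)
qed

lemma mirror_descent_exists:
  assumes "\<And>\<tau>. \<gamma> \<tau> > 0"
  shows "\<exists>y. mirror_descent Y \<omega> \<omega>' g t \<gamma> y"
proof -
  \<comment> \<open>Trajectories start at index \<open>1\<close>; the value at \<open>0\<close> is a dummy.\<close>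
  define y where "y n = rec_nat undefined
    (\<lambda>\<tau> v. if \<tau> = 0 then prox_center Y \<omega> else prox_map Y \<omega> \<omega>' v (\<gamma> \<tau> *\<^sub>R g v)) n" for n :: nat
  have "mirror_descent Y \<omega> \<omega>' g t \<gamma> y"
    unfolding mirror_descent_def y_def using assms by auto
  then show ?thesis by blast
qed

end


section \<open>The duality gap and the regret\<close>

lemma sum_step_weight:
  assumes "t \<ge> 1" "\<And>\<tau>. \<tau> \<in> {1..t} \<Longrightarrow> \<gamma> \<tau> > 0"
  shows "(\<Sum>\<tau>=1..t. \<gamma> \<tau>) > 0" and "(\<Sum>\<tau>=1..t. step_weight \<gamma> t \<tau>) = 1"
    and "\<tau> \<in> {1..t} \<Longrightarrow> step_weight \<gamma> t \<tau> \<ge> 0"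
proof -
  show pos: "(\<Sum>\<tau>=1..t. \<gamma> \<tau>) > 0"
    using assms by (intro sum_pos) auto
  then show "(\<Sum>\<tau>=1..t. step_weight \<gamma> t \<tau>) = 1"
    unfolding step_weight_def by (simp add: sum_divide_distrib[symmetric])
  show "step_weight \<gamma> t \<tau> \<ge> 0" if "\<tau> \<in> {1..t}"
    unfolding step_weight_def using assms(2)[OF that] pos by simp
qed

locale saddle_problem =
  fixes X :: "'a::euclidean_space set" and Y :: "'b::euclidean_space set"
    and xX :: "'a \<Rightarrow> 'a" and A :: "'b \<Rightarrow> 'a" and a :: 'a
    and \<psi> :: "'b \<Rightarrow> real" and \<psi>' :: "'b \<Rightarrow> 'b"
  assumes X: "X \<noteq> {}" "bounded X" "convex X"
    and maximizer: "\<And>\<xi>. xX \<xi> \<in> X" "\<And>\<xi> x. x \<in> X \<Longrightarrow> \<xi> \<bullet> x \<le> \<xi> \<bullet> xX \<xi>"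
    and Y: "Y \<noteq> {}" "convex Y" "compact Y"
    and A: "linear A"
    and \<psi>: "convex_on Y \<psi>" "continuous_on Y \<psi>"
    and \<psi>': "\<And>y. y \<in> Y \<Longrightarrow> \<psi>' y \<in> subdifferential Y \<psi> y"
begin

abbreviation \<phi> :: "'a \<Rightarrow> 'b \<Rightarrow> real" where "\<phi> \<equiv> saddle_fun A a \<psi>"
abbreviation f :: "'b \<Rightarrow> real" where "f \<equiv> dual_obj X A a \<psi>"
abbreviation f_star :: "'a \<Rightarrow> real" where "f_star \<equiv> primal_obj Y A a \<psi>"
abbreviation f' :: "'b \<Rightarrow> 'b" where "f' \<equiv> dual_field xX A a \<psi>'"

text \<open>
  Boundedness of the objectives ensures that the suprema and infima in their definitions
  are genuine bounds.
\<close>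

lemma saddle_fun_bounded: "\<exists>M. \<forall>x\<in>X. \<forall>y\<in>Y. \<bar>\<phi> x y\<bar> \<le> M"
proof -
  obtain B where B: "\<And>x. x \<in> X \<Longrightarrow> norm x \<le> B"
    using X(2) unfolding bounded_iff by blast
  have "continuous_on Y (\<lambda>y. A y + a)"
    by (intro continuous_intros linear_continuous_on linear_linear[THEN iffD2] A)
  then have "bounded ((\<lambda>y. A y + a) ` Y)" "bounded (\<psi> ` Y)"
    using compact_continuous_image[OF _ Y(3)] \<psi>(2) compact_imp_bounded by blast+
  then obtain C D where CD: "\<And>y. y \<in> Y \<Longrightarrow> norm (A y + a) \<le> C" "\<And>y. y \<in> Y \<Longrightarrow> \<bar>\<psi> y\<bar> \<le> D"
    unfolding bounded_iff by force
  have "\<bar>\<phi> x y\<bar> \<le> B * C + D" if "x \<in> X" "y \<in> Y" for x y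
  proof -
    have "\<bar>x \<bullet> (A y + a)\<bar> \<le> norm x * norm (A y + a)"
      by (rule Cauchy_Schwarz_ineq2)
    also have "\<dots> \<le> B * C"
      using B[OF that(1)] CD(1)[OF that(2)] by (intro mult_mono') auto
    finally show ?thesis
      unfolding saddle_fun_def using CD(2)[OF that(2)] by linarith
  qed
  then show ?thesis by blast
qed

lemma dual_opt_le: "y \<in> Y \<Longrightarrow> dual_opt X Y A a \<psi> \<le> f y"
  and primal_opt_ge: "x \<in> X \<Longrightarrow> f_star x \<le> primal_opt X Y A a \<psi>"
proof -
  obtain M where M: "\<And>x y. x \<in> X \<Longrightarrow> y \<in> Y \<Longrightarrow> \<bar>\<phi> x y\<bar> \<le> M"
    using saddle_fun_bounded by blast
  obtain x0 y0 where x0: "x0 \<in> X" and y0: "y0 \<in> Y" using X(1) Y(1) by blast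
  have "- M \<le> f y" if "y \<in> Y" for y
  proof -
    have "\<phi> x0 y \<le> f y"
      unfolding dual_obj_def using M[OF _ that]
      by (intro cSUP_upper x0 bdd_aboveI[where M = M]) fastforce
    then show ?thesis using M[OF x0 that] by linarith
  qed
  then show "dual_opt X Y A a \<psi> \<le> f y" if "y \<in> Y"
    unfolding dual_opt_def by (intro cINF_lower that bdd_belowI[where m = "- M"]) auto
  have "f_star x \<le> M" if "x \<in> X" for x
  proof -
    have "f_star x \<le> \<phi> x y0"
      unfolding primal_obj_def using M[OF that]
      by (intro cINF_lower y0 bdd_belowI[where m = "- M"]) fastforce
    then show ?thesis using M[OF that y0] by linarith
  qed
  then show "f_star x \<le> primal_opt X Y A a \<psi>" if "x \<in> X"
    unfolding primal_opt_def by (intro cSUP_upper that bdd_aboveI[where M = M]) auto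
qed

lemma convex_on_saddle_fun: "convex_on Y (\<phi> x)"
proof -
  have "convex_on Y (\<lambda>y. x \<bullet> (A y + a))"
    using Y(2)
    by (intro convex_onI) (auto simp: linear_add[OF A] linear_diff[OF A] linear_scale[OF A] algebra_simps)
  then show ?thesis
    unfolding saddle_fun_def using convex_on_add[OF _ \<psi>(1)] by blast
qed

text \<open>
  The choice of maximizer makes \<open>\<phi> (xX (A y + a)) y\<close> the value \<open>f y\<close>, and \<open>f' y\<close> is a subgradient at
  \<open>y\<close> of \<open>\<phi> (xX (A y + a))\<close>, not merely of \<open>f\<close>.  Hence it compares \<open>y\<close> with any \<open>z\<close> for the
  primal point that was selected at \<open>y\<close>.
\<close>

lemma saddle_fun_maximizer_diff_le:
  assumes x: "x \<in> X" and y: "y \<in> Y" and z: "z \<in> Y"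
  shows "\<phi> x y - \<phi> (xX (A y + a)) z \<le> f' y \<bullet> (y - z)"
proof -
  let ?x = "xX (A y + a)"
  have "\<phi> x y \<le> \<phi> ?x y"
    unfolding saddle_fun_def using maximizer(2)[OF x, of "A y + a"] by (simp add: inner_commute)
  moreover have "\<psi> y + \<psi>' y \<bullet> (z - y) \<le> \<psi> z"
    using \<psi>'[OF y] z unfolding subdifferential_def by blast
  moreover have "adjoint A ?x \<bullet> (y - z) = ?x \<bullet> (A y - A z)"
    using adjoint_works[OF A, of "y - z" ?x] by (simp add: inner_commute linear_diff[OF A])
  ultimately show ?thesis
    unfolding dual_field_def saddle_fun_def by (simp add: algebra_simps)
qed

lemma primal_approx_in:
  assumes "t \<ge> 1" "\<And>\<tau>. \<tau> \<in> {1..t} \<Longrightarrow> \<gamma> \<tau> > 0"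
  shows "primal_approx xX A a \<gamma> y t \<in> X"
  unfolding primal_approx_def
  using sum_step_weight[OF assms] maximizer(1) X(3) by (intro convex_sum) auto

lemma dual_approx_in:
  assumes "t \<ge> 1" "\<And>\<tau>. \<tau> \<in> {1..t} \<Longrightarrow> \<gamma> \<tau> > 0" "\<And>\<tau>. \<tau> \<in> {1..t} \<Longrightarrow> y \<tau> \<in> Y"
  shows "dual_approx \<gamma> y t \<in> Y"
  unfolding dual_approx_def
  using sum_step_weight[OF assms(1,2)] assms(3) Y(2) by (intro convex_sum) auto

text \<open>
  Averaging the previous inequality with the step weights: \<open>\<phi>\<close> is convex in its second argument
  and affine in its first.
\<close>

lemma duality_gap_le_regret:
  assumes t: "t \<ge> 1" and \<gamma>: "\<And>\<tau>. \<tau> \<in> {1..t} \<Longrightarrow> \<gamma> \<tau> > 0"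
    and y: "\<And>\<tau>. \<tau> \<in> {1..t} \<Longrightarrow> y \<tau> \<in> Y"
    and regret: "\<And>z. z \<in> Y \<Longrightarrow> (\<Sum>\<tau>=1..t. \<gamma> \<tau> * (f' (y \<tau>) \<bullet> (y \<tau> - z))) \<le> R"
  shows "f (dual_approx \<gamma> y t) - f_star (primal_approx xX A a \<gamma> y t) \<le> R / (\<Sum>\<tau>=1..t. \<gamma> \<tau>)"
proof -
  note w = sum_step_weight[where \<gamma> = \<gamma>, OF t \<gamma>]
  define x where "x \<tau> = xX (A (y \<tau>) + a)" for \<tau>
  let ?wt = "step_weight \<gamma> t"
  let ?x = "primal_approx xX A a \<gamma> y t" and ?y = "dual_approx \<gamma> y t"
  let ?S = "\<Sum>\<tau>=1..t. \<gamma> \<tau>"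
  have gap: "\<phi> u ?y - \<phi> ?x z \<le> R / ?S" if u: "u \<in> X" and z: "z \<in> Y" for u z
  proof -
    have "\<phi> u ?y \<le> (\<Sum>\<tau>=1..t. ?wt \<tau> * \<phi> u (y \<tau>))"
      unfolding dual_approx_def using w y t
      by (intro convex_on_sum[OF _ _ convex_on_saddle_fun]) auto
    moreover have "\<phi> ?x z = (\<Sum>\<tau>=1..t. ?wt \<tau> * \<phi> (x \<tau>) z)"
      unfolding saddle_fun_def primal_approx_def x_def[symmetric]
      using w(2) by (simp add: inner_sum_left distrib_left sum.distrib sum_distrib_right[symmetric])
    ultimately have "\<phi> u ?y - \<phi> ?x z \<le> (\<Sum>\<tau>=1..t. ?wt \<tau> * (\<phi> u (y \<tau>) - \<phi> (x \<tau>) z))"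
      by (simp add: right_diff_distrib sum_subtractf)
    also have "\<dots> \<le> (\<Sum>\<tau>=1..t. ?wt \<tau> * (f' (y \<tau>) \<bullet> (y \<tau> - z)))"
      unfolding x_def using w(3) y u z
      by (intro sum_mono mult_left_mono saddle_fun_maximizer_diff_le) auto
    also have "\<dots> = (\<Sum>\<tau>=1..t. \<gamma> \<tau> * (f' (y \<tau>) \<bullet> (y \<tau> - z))) / ?S"
      unfolding step_weight_def by (simp add: sum_divide_distrib)
    also have "\<dots> \<le> R / ?S"
      using regret[OF z] w(1) by (intro divide_right_mono) auto
    finally show ?thesis .
  qed
  have "f ?y - R / ?S \<le> \<phi> ?x z" if z: "z \<in> Y" for z
  proof -
    have "f ?y \<le> \<phi> ?x z + R / ?S"
      unfolding dual_obj_def using gap[OF _ z] by (intro cSUP_least X(1)) (smt (verit))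
    then show ?thesis by simp
  qed
  then have "f ?y - R / ?S \<le> f_star ?x"
    unfolding primal_obj_def by (intro cINF_greatest Y(1))
  then show ?thesis by simp
qed

end


section \<open>Mirror Descent for the saddle point problem\<close>

locale saddle_mirror_descent =
  saddle_problem X Y xX A a \<psi> \<psi>' + proximal_setup N Y \<omega> \<omega>'
  for X :: "'a::euclidean_space set" and Y :: "'b::euclidean_space set"
    and xX A a \<psi> \<psi>' N \<omega> \<omega>' +
  fixes L :: real
  assumes field_bound: "\<And>y. y \<in> Y \<Longrightarrow> conjugate_norm N (f' y) \<le> L"
begin

lemma mirror_descent_duality_gap:
  assumes md: "mirror_descent Y \<omega> \<omega>' f' t \<gamma> y" and t: "t \<ge> 1"
  shows "f (dual_approx \<gamma> y t) - f_star (primal_approx xX A a \<gamma> y t)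
    \<le> ((prox_radius Y \<omega>)\<^sup>2 + (\<Sum>\<tau>=1..t. (\<gamma> \<tau> * conjugate_norm N (f' (y \<tau>)))\<^sup>2)) / 2
      / (\<Sum>\<tau>=1..t. \<gamma> \<tau>)"
proof (rule duality_gap_le_regret[OF t _ _ mirror_descent_regret[OF md]])
  show "\<gamma> \<tau> > 0" "y \<tau> \<in> Y" if "\<tau> \<in> {1..t}" for \<tau>
    using md mirror_descent_in_domain[OF md] subdiff_domain_subset that
    unfolding mirror_descent_def by auto
qed

lemma mirror_descent_approx_in:
  assumes md: "mirror_descent Y \<omega> \<omega>' f' t \<gamma> y" and t: "t \<ge> 1"
  shows "primal_approx xX A a \<gamma> y t \<in> X" "dual_approx \<gamma> y t \<in> Y"
proof -
  have "\<gamma> \<tau> > 0" "y \<tau> \<in> Y" if "\<tau> \<in> {1..t}" for \<tau>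
    using md mirror_descent_in_domain[OF md] subdiff_domain_subset that
    unfolding mirror_descent_def by auto
  then show "primal_approx xX A a \<gamma> y t \<in> X" "dual_approx \<gamma> y t \<in> Y"
    using primal_approx_in[OF t] dual_approx_in[OF t] by blast+
qed

text \<open>
  The minimax theorem for this problem comes out of the algorithm itself: with constant steps
  \<open>1 / sqrt t\<close>, which make sense even where the field vanishes, the duality gap of the averages
  tends to zero, and it dominates \<open>dual_opt - primal_opt\<close>.
\<close>

lemma strong_duality: "dual_opt X Y A a \<psi> \<le> primal_opt X Y A a \<psi>"
proof -
  define K where "K = ((prox_radius Y \<omega>)\<^sup>2 + L\<^sup>2) / 2"
  have "dual_opt X Y A a \<psi> - primal_opt X Y A a \<psi> \<le> K / sqrt (real t)" if t: "t \<ge> 1" for t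
  proof -
    define \<gamma> :: "nat \<Rightarrow> real" where "\<gamma> \<tau> = 1 / sqrt (real t)" for \<tau>
    obtain y where y: "mirror_descent Y \<omega> \<omega>' f' t \<gamma> y"
      using mirror_descent_exists[of \<gamma> f' t] t unfolding \<gamma>_def by auto
    note approx = mirror_descent_approx_in[OF y t]
    have "(\<Sum>\<tau>=1..t. (\<gamma> \<tau> * conjugate_norm N (f' (y \<tau>)))\<^sup>2) \<le> (\<Sum>\<tau>=1..t. L\<^sup>2 / real t)"
    proof (rule sum_mono)
      fix \<tau> assume "\<tau> \<in> {1..t}"
      then have "y \<tau> \<in> Y"
        using mirror_descent_in_domain[OF y] subdiff_domain_subset by simp
      then have "(conjugate_norm N (f' (y \<tau>)))\<^sup>2 \<le> L\<^sup>2"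
        by (intro power_mono field_bound conjugate_norm_nonneg[OF norm])
      then show "(\<gamma> \<tau> * conjugate_norm N (f' (y \<tau>)))\<^sup>2 \<le> L\<^sup>2 / real t"
        unfolding \<gamma>_def using t by (simp add: power_divide divide_right_mono)
    qed
    then have sq: "(\<Sum>\<tau>=1..t. (\<gamma> \<tau> * conjugate_norm N (f' (y \<tau>)))\<^sup>2) \<le> L\<^sup>2"
      using t by simp
    have sum: "(\<Sum>\<tau>=1..t. \<gamma> \<tau>) = sqrt (real t)"
      unfolding \<gamma>_def by (simp add: real_div_sqrt)
    have "dual_opt X Y A a \<psi> - primal_opt X Y A a \<psi>
        \<le> f (dual_approx \<gamma> y t) - f_star (primal_approx xX A a \<gamma> y t)"
      using dual_opt_le[OF approx(2)] primal_opt_ge[OF approx(1)] by linarith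
    also have "\<dots> \<le> K / sqrt (real t)"
      using mirror_descent_duality_gap[OF y t] sq unfolding K_def sum
      by (smt (verit) divide_right_mono real_sqrt_ge_zero of_nat_0_le_iff)
    finally show ?thesis .
  qed
  then have "\<forall>\<^sub>F t in sequentially. dual_opt X Y A a \<psi> - primal_opt X Y A a \<psi> \<le> K / sqrt (real t)"
    unfolding eventually_sequentially by blast
  moreover have "(\<lambda>t. K / sqrt (real t)) \<longlonglongrightarrow> 0"
    by (intro tendsto_divide_0[OF tendsto_const] filterlim_at_top_imp_at_infinity
        filterlim_compose[OF sqrt_at_top] filterlim_real_sequentially)
  ultimately have "dual_opt X Y A a \<psi> - primal_opt X Y A a \<psi> \<le> 0"
    by (intro tendsto_lowerbound) auto
  then show ?thesis by simp
qed

lemma normalized_parameters_pos: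
  assumes nmd: "normalized_mirror_descent N Y \<omega> \<omega>' f' t \<gamma> y" and t: "t \<ge> 1"
  shows "prox_radius Y \<omega> > 0" "L > 0"
proof -
  have "1 \<in> {1..t}" using t by simp
  then have 1: "\<gamma> 1 > 0" "f' (y 1) \<noteq> 0"
    "\<gamma> 1 = prox_radius Y \<omega> / (sqrt (real t) * conjugate_norm N (f' (y 1)))"
    using nmd unfolding normalized_mirror_descent_def mirror_descent_def by blast+
  have c: "conjugate_norm N (f' (y 1)) > 0"
    by (rule conjugate_norm_pos[OF norm 1(2)])
  then show "prox_radius Y \<omega> > 0"
    using 1(1) t unfolding 1(3) by (simp add: zero_less_divide_iff mult_less_0_iff)
  have "y 1 \<in> Y"
    using nmd mirror_descent_in_domain[of f' t \<gamma> y 1] subdiff_domain_subset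
    unfolding normalized_mirror_descent_def by simp
  then show "L > 0"
    using c field_bound by fastforce
qed

text \<open>
  Normalization makes every term \<open>(\<gamma> \<tau> * conjugate_norm N (f' (y \<tau>)))\<^sup>2\<close> equal to
  \<open>(prox_radius Y \<omega>)\<^sup>2 / t\<close>, and each step is at least \<open>prox_radius Y \<omega> / (sqrt t * L)\<close>.
\<close>

lemma normalized_duality_gap:
  assumes nmd: "normalized_mirror_descent N Y \<omega> \<omega>' f' t \<gamma> y" and t: "t \<ge> 1"
  shows "f (dual_approx \<gamma> y t) - f_star (primal_approx xX A a \<gamma> y t)
    \<le> prox_radius Y \<omega> * L / sqrt (real t)"
proof -
  let ?\<Omega> = "prox_radius Y \<omega>"
  note pos = normalized_parameters_pos[OF nmd t]
  have md: "mirror_descent Y \<omega> \<omega>' f' t \<gamma> y"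
    using nmd unfolding normalized_mirror_descent_def by blast
  have \<gamma>: "\<gamma> \<tau> * conjugate_norm N (f' (y \<tau>)) = ?\<Omega> / sqrt (real t)"
    "?\<Omega> / (sqrt (real t) * L) \<le> \<gamma> \<tau>" if \<tau>: "\<tau> \<in> {1..t}" for \<tau>
  proof -
    have eq: "\<gamma> \<tau> = ?\<Omega> / (sqrt (real t) * conjugate_norm N (f' (y \<tau>)))"
      and c: "conjugate_norm N (f' (y \<tau>)) > 0"
      using nmd \<tau> conjugate_norm_pos[OF norm] unfolding normalized_mirror_descent_def by auto
    show "\<gamma> \<tau> * conjugate_norm N (f' (y \<tau>)) = ?\<Omega> / sqrt (real t)"
      unfolding eq using c by simp
    have "y \<tau> \<in> Y"
      using mirror_descent_in_domain[OF md] \<tau> subdiff_domain_subset by simp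
    then show "?\<Omega> / (sqrt (real t) * L) \<le> \<gamma> \<tau>"
      unfolding eq using pos c t field_bound
      by (intro divide_left_mono mult_left_mono mult_pos_pos) auto
  qed
  have "(\<Sum>\<tau>=1..t. (\<gamma> \<tau> * conjugate_norm N (f' (y \<tau>)))\<^sup>2) = (\<Sum>\<tau>=1..t. ?\<Omega>\<^sup>2 / real t)"
    using \<gamma>(1) by (intro sum.cong) (auto simp: power_divide)
  then have sq: "(\<Sum>\<tau>=1..t. (\<gamma> \<tau> * conjugate_norm N (f' (y \<tau>)))\<^sup>2) = ?\<Omega>\<^sup>2"
    using t by simp
  have "(\<Sum>\<tau>=1..t. ?\<Omega> / (sqrt (real t) * L)) \<le> (\<Sum>\<tau>=1..t. \<gamma> \<tau>)"
    by (intro sum_mono \<gamma>(2))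
  moreover have "(\<Sum>\<tau>=1..t. ?\<Omega> / (sqrt (real t) * L)) = sqrt (real t) * ?\<Omega> / L"
    using t pos(2) by (simp add: field_simps)
  ultimately have "sqrt (real t) * ?\<Omega> / L \<le> (\<Sum>\<tau>=1..t. \<gamma> \<tau>)"
    by simp
  then have "?\<Omega>\<^sup>2 / (\<Sum>\<tau>=1..t. \<gamma> \<tau>) \<le> ?\<Omega>\<^sup>2 / (sqrt (real t) * ?\<Omega> / L)"
    using pos t by (intro divide_left_mono mult_pos_pos) (auto intro: less_le_trans[rotated])
  also have "\<dots> = ?\<Omega> * L / sqrt (real t)"
    using pos by (simp add: power2_eq_square)
  finally show ?thesis
    using mirror_descent_duality_gap[OF md t] unfolding sq by simp
qed

text \<open>By strong duality the sum of the two optimality gaps is at most the duality gap.\<close>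

lemma normalized_optimality_gaps:
  assumes "normalized_mirror_descent N Y \<omega> \<omega>' f' t \<gamma> y" and "t \<ge> 1"
  shows "(f (dual_approx \<gamma> y t) - primal_opt X Y A a \<psi>)
      + (dual_opt X Y A a \<psi> - f_star (primal_approx xX A a \<gamma> y t))
    \<le> prox_radius Y \<omega> * L / sqrt (real t)"
  using normalized_duality_gap[OF assms] strong_duality by linarith

end

theorem corollary3p1:
  fixes X :: "'a::euclidean_space set" and Y :: "'b::euclidean_space set"
    and xX :: "'a \<Rightarrow> 'a" and A :: "'b \<Rightarrow> 'a" and a :: 'a
    and \<psi> :: "'b \<Rightarrow> real" and \<psi>' :: "'b \<Rightarrow> 'b"
    and N :: "'b \<Rightarrow> real" and \<omega> :: "'b \<Rightarrow> real" and \<omega>' :: "'b \<Rightarrow> 'b"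
    and L :: real
  assumes X: "X \<noteq> {}" "closed X" "bounded X" "convex X"
    and xX: "\<And>\<xi>. xX \<xi> \<in> X" "\<And>\<xi> x. x \<in> X \<Longrightarrow> \<xi> \<bullet> x \<le> \<xi> \<bullet> xX \<xi>"
    and Y: "Y \<noteq> {}" "convex Y" "compact Y"
    and A: "linear A"
    and \<psi>: "convex_on Y \<psi>" "\<exists>C. C-lipschitz_on Y \<psi>"
    and \<psi>': "\<And>y. y \<in> Y \<Longrightarrow> \<psi>' y \<in> subdifferential Y \<psi> y"
    and N: "is_norm N"
    and \<omega>: "distance_generating N Y \<omega> \<omega>'"
    and L_finite: "bdd_above ((\<lambda>y. conjugate_norm N (dual_field xX A a \<psi>' y)) ` Y)"
    and L: "L = (SUP y\<in>Y. conjugate_norm N (dual_field xX A a \<psi>' y))"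
  shows "(\<forall>t\<ge>1. \<forall>\<gamma> y.
            normalized_mirror_descent N Y \<omega> \<omega>' (dual_field xX A a \<psi>') t \<gamma> y \<longrightarrow>
              primal_approx xX A a \<gamma> y t \<in> X \<and>
              dual_approx \<gamma> y t \<in> Y \<and>
              (dual_obj X A a \<psi> (dual_approx \<gamma> y t) - primal_opt X Y A a \<psi>)
                + (dual_opt X Y A a \<psi> - primal_obj Y A a \<psi> (primal_approx xX A a \<gamma> y t))
              \<le> prox_radius Y \<omega> * L / sqrt (real t)) \<and>
         (\<forall>\<epsilon>>0. \<forall>t\<ge>1. \<forall>\<gamma> y.
            normalized_mirror_descent N Y \<omega> \<omega>' (dual_field xX A a \<psi>') t \<gamma> y \<longrightarrow>
              1 \<le> nat \<lceil>(prox_radius Y \<omega>)\<^sup>2 * L\<^sup>2 / \<epsilon>\<^sup>2\<rceil> \<and>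
              (nat \<lceil>(prox_radius Y \<omega>)\<^sup>2 * L\<^sup>2 / \<epsilon>\<^sup>2\<rceil> \<le> t \<longrightarrow>
                (dual_obj X A a \<psi> (dual_approx \<gamma> y t) - primal_opt X Y A a \<psi>)
                  + (dual_opt X Y A a \<psi> - primal_obj Y A a \<psi> (primal_approx xX A a \<gamma> y t))
                \<le> \<epsilon>))"
proof -
  have "continuous_on Y \<psi>"
    using \<psi>(2) lipschitz_on_continuous_on by blast
  have "conjugate_norm N (dual_field xX A a \<psi>' y) \<le> L" if "y \<in> Y" for y
    unfolding L using that L_finite by (rule cSUP_upper)
  interpret saddle_mirror_descent X Y xX A a \<psi> \<psi>' N \<omega> \<omega>' L
    by (intro saddle_mirror_descent.intro saddle_problem.intro proximal_setup.intro
        saddle_mirror_descent_axioms.intro; fact)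
  let ?\<Omega> = "prox_radius Y \<omega>"
  show ?thesis
  proof (intro conjI allI impI)
    fix t :: nat and \<gamma> y
    assume t: "1 \<le> t" and nmd: "normalized_mirror_descent N Y \<omega> \<omega>' f' t \<gamma> y"
    then have "mirror_descent Y \<omega> \<omega>' f' t \<gamma> y"
      unfolding normalized_mirror_descent_def by blast
    then show "primal_approx xX A a \<gamma> y t \<in> X" "dual_approx \<gamma> y t \<in> Y"
      using mirror_descent_approx_in t by blast+
    show "(f (dual_approx \<gamma> y t) - primal_opt X Y A a \<psi>)
        + (dual_opt X Y A a \<psi> - f_star (primal_approx xX A a \<gamma> y t)) \<le> ?\<Omega> * L / sqrt (real t)"
      by (rule normalized_optimality_gaps[OF nmd t])
  next
    fix \<epsilon> :: real and t :: nat and \<gamma> y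
    assume \<epsilon>: "0 < \<epsilon>" and t: "1 \<le> t" and nmd: "normalized_mirror_descent N Y \<omega> \<omega>' f' t \<gamma> y"
    note pos = normalized_parameters_pos[OF nmd t]
    show "1 \<le> nat \<lceil>?\<Omega>\<^sup>2 * L\<^sup>2 / \<epsilon>\<^sup>2\<rceil>"
      using pos \<epsilon> by (simp add: Suc_le_eq)
    assume "nat \<lceil>?\<Omega>\<^sup>2 * L\<^sup>2 / \<epsilon>\<^sup>2\<rceil> \<le> t"
    then have "?\<Omega>\<^sup>2 * L\<^sup>2 / \<epsilon>\<^sup>2 \<le> real t"
      by linarith
    then have "(?\<Omega> * L / \<epsilon>)\<^sup>2 \<le> real t"
      by (simp add: power_mult_distrib power_divide)
    then have "?\<Omega> * L / \<epsilon> \<le> sqrt (real t)"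
      by (rule real_le_rsqrt)
    then have "?\<Omega> * L / sqrt (real t) \<le> \<epsilon>"
      using \<epsilon> t by (simp add: field_simps)
    then show "(f (dual_approx \<gamma> y t) - primal_opt X Y A a \<psi>)
        + (dual_opt X Y A a \<psi> - f_star (primal_approx xX A a \<gamma> y t)) \<le> \<epsilon>"
      using normalized_optimality_gaps[OF nmd t] by linarith
  qed
qed

end
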